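(* Let $G\colon\mathbb{R}^2\to\mathbb{R}^2$ be a $C^1$ map. Then the following are equivalent: (1) $G$ is a non-linear unipotent map such that $G(0,0)=(0,0)$. (2) There is a rotation $R_\theta$ (for some $\theta\in\mathbb{R}$) such that $$\big(R_\theta\circ G\circ R_{-\theta}\big)(x,y)=\big(x+\psi(y),y\big)\quad\text{for all }(x,y)\in\mathbb{R}^2,$$ where $\psi\colon\mathbb{R}\to\mathbb{R}$ is a non-linear $C^1$ function such that $\psi(0)=0$.
   Context: A differentiable map $G\colon\mathbb{R}^2\to\mathbb{R}^2$ is called unipotent if its spectrum $\mathrm{Spc}(G)=\{\text{eigenvalues of } DG_z : z\in\mathbb{R}^2\}\subset\mathbb{C}$ is the set $\{1\}$. For $\theta\in\mathbb{R}$, $R_\theta=\begin{bmatrix}\cos\theta&-\sin\theta\\ \sin\theta&\cos\theta\end{bmatrix}$ denotes the linear rotation of $\mathbb{R}^2$. *)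

theory Defs
  imports "HOL-Analysis.Analysis"
begin

definition C1_map :: "(real^'n \<Rightarrow> real^'m) \<Rightarrow> bool" where
  "C1_map G \<longleftrightarrow> (\<forall>z. G differentiable (at z)) \<and> continuous_on UNIV (\<lambda>z. jacobian G (at z))"

definition eigenvalues :: "complex^'n^'n \<Rightarrow> complex set" where
  "eigenvalues A = {\<mu>. \<exists>v. v \<noteq> 0 \<and> A *v v = \<mu> *s v}"

text \<open>The eigenvalues of the real Jacobian matrices are taken over the complex numbers,
  so the entries are first embedded with \<^term>\<open>complex_of_real\<close>. The definition is meaningful
  only for differentiable \<^term>\<open>G\<close>.\<close>

definition Spc :: "(real^'n \<Rightarrow> real^'n) \<Rightarrow> complex set" where
  "Spc G = (\<Union>z. eigenvalues (map_matrix complex_of_real (jacobian G (at z))))"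

definition unipotent :: "(real^2 \<Rightarrow> real^2) \<Rightarrow> bool" where
  "unipotent G \<longleftrightarrow> (\<forall>z. G differentiable (at z)) \<and> Spc G = {1}"

definition rotation :: "real \<Rightarrow> real^2 \<Rightarrow> real^2" where
  "rotation \<theta> z = (vector [vector [cos \<theta>, - sin \<theta>], vector [sin \<theta>, cos \<theta>]] :: real^2^2) *v z"

end

theory Submission
  imports Defs
begin

text \<open>
  Write \<open>G = id + F\<close>. In dimension two, the spectrum of \<open>G\<close> is \<open>{1}\<close> exactly when every \<open>DF z\<close> has
  trace and determinant zero, that is, when \<open>DF\<close> is nilpotent everywhere. A map
  \<open>F z = \<psi> (w \<bullet> z) v\<close> with \<open>v\<close> and \<open>w\<close> orthogonal unit vectors has this property, and a rotation brings
  \<open>id + F\<close> into the form \<open>(x + \<psi> y, y)\<close>. The content of the theorem is the converse: a \<open>C\<^sup>1\<close> map of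
  the plane with nilpotent derivative, vanishing at the origin, has this form. It is a
  version of the Hartman-Nirenberg theorem that complete developable graphs are cylinders
  (\<open>F\<close> is a rotated gradient of a function whose Hessian determinant is zero).

  For a nilpotent nonzero \<open>2 \<times> 2\<close> matrix, kernel and image are the same line. Near a point with
  \<open>DF \<noteq> 0\<close> the map \<open>F\<close> has rank one, so it is constant on its level curves, and those are
  tangent to the kernel. The image of \<open>DF\<close> is the tangent of the image curve of \<open>F\<close>, which is the same
  along a level curve. Therefore the level curves have a constant direction and are straight
  (\<open>kernel_line_local\<close>). Along such a line the reciprocal of the entry \<open>b\<close> of \<open>DF\<close> is an affine
  function; it stays bounded on bounded pieces, so \<open>b\<close> cannot vanish at the end of a
  segment, and the segment extends to the complete line (\<open>kernel_line\<close>). Complete lines with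
  different directions would meet, which is impossible (\<open>slope_unique\<close>). So all kernels
  contain one common vector \<open>v\<close> (\<open>common_kernel\<close>), and integration yields the form of \<open>F\<close>
  (\<open>shear_form\<close>).
\<close>

section \<open>Unipotent matrices of size two\<close>

text \<open>This is the criterion that \<open>\<mu>\<close> is a root of the characteristic polynomial. For \<open>2 \<times> 2\<close>
  matrices the eigenvector can be written down: a nonzero row \<open>(p, q)\<close> of \<open>M - \<mu>\<close> is annihilated
  by \<open>(- q, p)\<close>, and the other row is then annihilated because the determinant vanishes.\<close>

lemma eigenvalue_iff_2:
  fixes M :: "complex^2^2"
  shows "\<mu> \<in> eigenvalues M \<longleftrightarrow> (M$1$1 - \<mu>) * (M$2$2 - \<mu>) = M$1$2 * M$2$1" (is "_ \<longleftrightarrow> ?char")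
proof -
  have eig: "\<mu> \<in> eigenvalues M \<longleftrightarrow> (\<exists>x y. (x \<noteq> 0 \<or> y \<noteq> 0) \<and> (M$1$1 - \<mu>) * x + M$1$2 * y = 0 \<and> M$2$1 * x + (M$2$2 - \<mu>) * y = 0)"
    (is "_ \<longleftrightarrow> ?R")
  proof
    assume "\<mu> \<in> eigenvalues M"
    then obtain v where "v \<noteq> 0" "M *v v = \<mu> *s v" by (auto simp: eigenvalues_def)
    then show ?R
      by (intro exI[of _ "v$1"] exI[of _ "v$2"])
         (auto simp: vec_eq_iff forall_2 matrix_vector_mult_def sum_2 algebra_simps)
  next
    assume ?R
    then obtain x y where xy: "x \<noteq> 0 \<or> y \<noteq> 0" "(M$1$1 - \<mu>) * x + M$1$2 * y = 0" "M$2$1 * x + (M$2$2 - \<mu>) * y = 0"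
      by blast
    then have "M *v vector [x, y] = \<mu> *s vector [x, y]" "vector [x, y] \<noteq> (0 :: complex^2)"
      by (auto simp: vec_eq_iff forall_2 matrix_vector_mult_def sum_2 algebra_simps vector_2)
    then show "\<mu> \<in> eigenvalues M" unfolding eigenvalues_def by blast
  qed
  show ?thesis
    unfolding eig
  proof
    assume "\<exists>x y. (x \<noteq> 0 \<or> y \<noteq> 0) \<and> (M$1$1 - \<mu>) * x + M$1$2 * y = 0 \<and> M$2$1 * x + (M$2$2 - \<mu>) * y = 0"
    then obtain x y where xy: "x \<noteq> 0 \<or> y \<noteq> 0" "(M$1$1 - \<mu>) * x + M$1$2 * y = 0" "M$2$1 * x + (M$2$2 - \<mu>) * y = 0"
      by blast
    let ?d = "(M$1$1 - \<mu>) * (M$2$2 - \<mu>) - M$1$2 * M$2$1"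
    have "?d * x = (M$2$2 - \<mu>) * ((M$1$1 - \<mu>) * x + M$1$2 * y) - M$1$2 * (M$2$1 * x + (M$2$2 - \<mu>) * y)"
      by (simp add: algebra_simps)
    moreover have "?d * y = (M$1$1 - \<mu>) * (M$2$1 * x + (M$2$2 - \<mu>) * y) - M$2$1 * ((M$1$1 - \<mu>) * x + M$1$2 * y)"
      by (simp add: algebra_simps)
    ultimately have "?d * x = 0" "?d * y = 0" by (simp_all only: xy) simp_all
    then show ?char using xy(1) by auto
  next
    assume ch: ?char
    consider "M$1$1 - \<mu> \<noteq> 0 \<or> M$1$2 \<noteq> 0" | "M$2$1 \<noteq> 0 \<or> M$2$2 - \<mu> \<noteq> 0"
      | "M$1$1 - \<mu> = 0 \<and> M$1$2 = 0 \<and> M$2$1 = 0 \<and> M$2$2 - \<mu> = 0" by blast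
    then show "\<exists>x y. (x \<noteq> 0 \<or> y \<noteq> 0) \<and> (M$1$1 - \<mu>) * x + M$1$2 * y = 0 \<and> M$2$1 * x + (M$2$2 - \<mu>) * y = 0"
    proof cases
      case 1
      then show ?thesis using ch
        by (intro exI[of _ "- M$1$2"] exI[of _ "M$1$1 - \<mu>"]) (auto simp: mult.commute)
    next
      case 2
      then show ?thesis using ch
        by (intro exI[of _ "M$2$2 - \<mu>"] exI[of _ "- M$2$1"]) (auto simp: mult.commute)
    next
      case 3
      then show ?thesis by (intro exI[of _ 1]) auto
    qed
  qed
qed

lemma eigenvalue_of_real_iff:
  fixes A :: "real^2^2" and \<mu> :: complex
  shows "\<mu> \<in> eigenvalues (map_matrix complex_of_real A) \<longleftrightarrow>
    \<mu>\<^sup>2 - of_real (A$1$1 + A$2$2) * \<mu> + of_real (A$1$1 * A$2$2 - A$1$2 * A$2$1) = 0"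
  unfolding eigenvalue_iff_2 by (auto simp: map_matrix_def algebra_simps power2_eq_square)

text \<open>Both complex roots of the characteristic polynomial must be \<open>1\<close>, so the trace is \<open>2\<close> and the
  discriminant vanishes. The conclusion says that \<open>A - 1\<close> has trace and determinant zero, that
  is, \<open>A - 1\<close> is nilpotent.\<close>

lemma eigenvalues_subset_1D:
  fixes A :: "real^2^2"
  assumes "eigenvalues (map_matrix complex_of_real A) \<subseteq> {1}"
  shows "A$1$1 + A$2$2 = 2" "(A$1$1 - 1) * (A$2$2 - 1) = A$1$2 * A$2$1"
proof -
  define t d where "t = A$1$1 + A$2$2" and "d = A$1$1 * A$2$2 - A$1$2 * A$2$1"
  have one: "\<mu> = 1" if "\<mu>\<^sup>2 - t * \<mu> + d = 0" for \<mu> :: complex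
    using eigenvalue_of_real_iff[of \<mu> A] that assms unfolding t_def d_def by blast
  define s where "s = csqrt (t\<^sup>2 - 4 * d)"
  have s: "s * s = t\<^sup>2 - 4 * d" by (simp add: s_def flip: power2_eq_square)
  have "(t + s) / 2 = 1" "(t - s) / 2 = 1"
    by (rule one, simp add: power2_eq_square field_simps s)+
  then have "complex_of_real t + s = 2" "complex_of_real t - s = 2" by simp_all
  then have "complex_of_real t = 2" "s = 0" by (auto simp: algebra_simps)
  then have t: "t = 2" by (metis of_real_eq_iff of_real_numeral)
  have "complex_of_real (t\<^sup>2 - 4 * d) = 0" using s \<open>s = 0\<close> by simp
  then have "t\<^sup>2 - 4 * d = 0" by (simp only: of_real_eq_0_iff)
  with t have "d = 1" by simp
  with t show "A$1$1 + A$2$2 = 2" "(A$1$1 - 1) * (A$2$2 - 1) = A$1$2 * A$2$1"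
    by (simp_all add: t_def d_def algebra_simps)
qed

lemma eigenvalues_eq_1:
  fixes A :: "real^2^2"
  assumes "A$1$1 + A$2$2 = 2" "(A$1$1 - 1) * (A$2$2 - 1) = A$1$2 * A$2$1"
  shows "eigenvalues (map_matrix complex_of_real A) = {1}"
proof -
  have d: "A$1$1 * A$2$2 - A$1$2 * A$2$1 = 1"
    using assms by (simp add: algebra_simps)
  have "\<mu> \<in> eigenvalues (map_matrix complex_of_real A) \<longleftrightarrow> (\<mu> - 1)\<^sup>2 = 0" for \<mu> :: complex
    unfolding eigenvalue_of_real_iff assms(1) d by (simp add: power2_eq_square algebra_simps)
  then show ?thesis by auto
qed

section \<open>Plane maps with nilpotent derivative\<close>

lemma cos_sin_mult: "cos \<theta> * (cos \<theta> * x) + sin \<theta> * (sin \<theta> * x) = x" for x :: real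
  by (simp flip: mult.assoc distrib_right)

text \<open>The displacement \<open>F = G - id = (f, g)\<close> of a unipotent map has a nilpotent derivative
  \<open>DF = ((a, b), (k, - a))\<close>: the vanishing trace is built into the shape of the matrix, and the
  vanishing determinant is the assumption \<open>det_zero\<close>. Points live in \<open>real \<times> real\<close> rather than
  \<open>real^2\<close>, so that partial functions in one coordinate are easy to form.\<close>

locale nilpotent_plane_map =
  fixes f g a b k :: "real \<times> real \<Rightarrow> real"
  assumes deriv_f: "(f has_derivative (\<lambda>h. a z * fst h + b z * snd h)) (at z)"
    and deriv_g: "(g has_derivative (\<lambda>h. k z * fst h - a z * snd h)) (at z)"
    and det_zero: "a z * a z + b z * k z = 0"
    and cont_a: "continuous_on UNIV a"
    and cont_b: "continuous_on UNIV b"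
    and cont_k: "continuous_on UNIV k"
begin

text \<open>Where \<open>b\<close> does not vanish, the vector \<open>(1, slope z)\<close> spans both the kernel and the image of
  \<open>DF z\<close>. The equality of these two lines is what nilpotency means, and everything below rests
  on it.\<close>

definition slope :: "real \<times> real \<Rightarrow> real" where
  "slope z = - a z / b z"

lemma a_eq: "b z \<noteq> 0 \<Longrightarrow> a z = - slope z * b z"
  by (simp add: slope_def)

lemma k_eq:
  assumes "b z \<noteq> 0"
  shows "k z = - (slope z)\<^sup>2 * b z"
proof -
  have "b z * k z = b z * (- (slope z)\<^sup>2 * b z)"
    using det_zero[of z] a_eq[OF assms] by (simp add: power2_eq_square algebra_simps)
  then show ?thesis using assms by (simp only: mult_cancel_left) blast
qed

text \<open>Near a point with \<open>b \<noteq> 0\<close> the level curves of \<open>f\<close> are graphs over the first axis: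
  \<open>(t, Y (t, c))\<close> is the point at abscissa \<open>t\<close> on the level curve \<open>f = c\<close>. Formally, \<open>Y\<close> is the
  second component of the inverse of the map \<open>z \<mapsto> (fst z, f z)\<close>, whose image is open by invariance of
  domain. The derivative of \<open>Y\<close> shows that a level curve has slope \<open>slope\<close> at each of its points.\<close>

lemma level_chart:
  assumes "b p \<noteq> 0"
  obtains Y \<delta> where "\<delta> > 0" "Y (fst p, f p) = snd p"
    "\<And>t c. \<bar>t - fst p\<bar> < \<delta> \<Longrightarrow> \<bar>c - f p\<bar> < \<delta> \<Longrightarrow> b (t, Y (t, c)) \<noteq> 0"
    "\<And>t c. \<bar>t - fst p\<bar> < \<delta> \<Longrightarrow> \<bar>c - f p\<bar> < \<delta> \<Longrightarrow>
       (Y has_derivative (\<lambda>h. slope (t, Y (t, c)) * fst h + snd h / b (t, Y (t, c)))) (at (t, c))"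
proof -
  define \<Phi> where "\<Phi> z = (fst z, f z)" for z
  have "open {z. b z \<noteq> 0}"
    using open_Collect_neq[OF cont_b continuous_on_const] by simp
  then obtain r where r: "r > 0" "ball p r \<subseteq> {z. b z \<noteq> 0}"
    using assms open_contains_ball by blast
  have cont: "continuous_on (ball p r) \<Phi>"
    unfolding \<Phi>_def
    by (intro continuous_intros continuous_at_imp_continuous_on ballI has_derivative_continuous[OF deriv_f])
  \<comment> \<open>Two points with the same first coordinate and the same value of \<open>f\<close> would give a zero of
    \<open>b\<close> between them, by the mean value theorem.\<close>
  have inj: "inj_on \<Phi> (ball p r)"
  proof (rule inj_onI)
    fix z z' assume z: "z \<in> ball p r" "z' \<in> ball p r" and eq: "\<Phi> z = \<Phi> z'"
    have seg: "closed_segment z z' \<subseteq> ball p r"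
      using z by (simp add: closed_segment_subset)
    have "\<exists>u\<in>{0<..<1}. f (z + 1 *\<^sub>R (z' - z)) - f (z + 0 *\<^sub>R (z' - z))
             = (\<lambda>s. s * (b (z + u *\<^sub>R (z' - z)) * (snd z' - snd z))) (1 - 0)"
    proof (rule mvt_simple)
      fix u :: real
      have "((\<lambda>u. f (z + u *\<^sub>R (z' - z))) has_derivative
          (\<lambda>s. a (z + u *\<^sub>R (z' - z)) * fst (s *\<^sub>R (z' - z)) + b (z + u *\<^sub>R (z' - z)) * snd (s *\<^sub>R (z' - z))))
          (at u within {0..1})"
        by (rule has_derivative_compose[OF _ deriv_f]) (auto intro!: derivative_eq_intros)
      moreover have "fst (z' - z) = 0" using eq by (simp add: \<Phi>_def)
      ultimately show "((\<lambda>u. f (z + u *\<^sub>R (z' - z))) has_derivative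
          (\<lambda>s. s * (b (z + u *\<^sub>R (z' - z)) * (snd z' - snd z)))) (at u within {0..1})"
        by (simp add: mult_ac)
    qed simp
    then obtain u where u: "0 < u" "u < 1" "b (z + u *\<^sub>R (z' - z)) * (snd z' - snd z) = 0"
      using eq by (auto simp: \<Phi>_def)
    have "z + u *\<^sub>R (z' - z) \<in> closed_segment z z'"
      using u(1,2) by (auto simp: in_segment algebra_simps intro!: exI[of _ u])
    then have "b (z + u *\<^sub>R (z' - z)) \<noteq> 0" using seg r by blast
    then show "z = z'" using u eq by (auto simp: \<Phi>_def prod_eq_iff)
  qed
  define W where "W = \<Phi> ` ball p r"
  have "open W" unfolding W_def by (rule invariance_of_domain[OF cont open_ball inj])
  moreover have "(fst p, f p) \<in> W" using r by (auto simp: W_def \<Phi>_def)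
  ultimately obtain A B where AB: "open A" "open B" "fst p \<in> A" "f p \<in> B" "A \<times> B \<subseteq> W"
    by (auto elim!: open_prod_elim)
  obtain d where d: "d > 0" "ball (fst p) d \<subseteq> A" using AB open_contains_ball by blast
  obtain e where e: "e > 0" "ball (f p) e \<subseteq> B" using AB open_contains_ball by blast
  define \<Psi> where "\<Psi> = inv_into (ball p r) \<Phi>"
  have \<Psi>: "\<Psi> w \<in> ball p r" "\<Phi> (\<Psi> w) = w" if "w \<in> W" for w
    using that unfolding W_def \<Psi>_def by (simp_all only: inv_into_into f_inv_into_f)
  have pair: "\<Psi> w = (fst w, snd (\<Psi> w))" if "w \<in> W" for w
    using \<Psi>(2)[OF that] by (auto simp: \<Phi>_def prod_eq_iff)
  have der: "((\<lambda>w. snd (\<Psi> w)) has_derivative (\<lambda>h. slope (\<Psi> w) * fst h + snd h / b (\<Psi> w))) (at w)"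
    if w: "w \<in> W" for w
  proof -
    have nz: "b (\<Psi> w) \<noteq> 0" using \<Psi>(1)[OF w] r by blast
    have "(\<Psi> has_derivative (\<lambda>h. (fst h, slope (\<Psi> w) * fst h + snd h / b (\<Psi> w)))) (at w)"
    proof (rule has_derivative_inverse_strong_x[of "ball p r" \<Psi> w \<Phi>, OF open_ball \<Psi>(1)[OF w] cont])
      show "\<Psi> (\<Phi> x) = x" if "x \<in> ball p r" for x
        unfolding \<Psi>_def by (rule inv_into_f_f[OF inj that])
      show "(\<Phi> has_derivative (\<lambda>h. (fst h, a (\<Psi> w) * fst h + b (\<Psi> w) * snd h))) (at (\<Psi> w))"
        unfolding \<Phi>_def by (intro has_derivative_Pair deriv_f derivative_intros)
      show "(\<lambda>h. (fst h, a (\<Psi> w) * fst h + b (\<Psi> w) * snd h)) \<circ>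
            (\<lambda>h. (fst h, slope (\<Psi> w) * fst h + snd h / b (\<Psi> w))) = id"
        using nz by (simp add: fun_eq_iff a_eq[OF nz] distrib_left)
      show "\<Phi> (\<Psi> w) = w" by (rule \<Psi>(2)[OF w])
    qed
    from has_derivative_snd[OF this] show ?thesis by simp
  qed
  show thesis
  proof (rule that[of "min d e" "\<lambda>w. snd (\<Psi> w)"])
    show "min d e > 0" using d e by simp
    have "\<Psi> (\<Phi> p) = p" unfolding \<Psi>_def using r by (intro inv_into_f_f[OF inj]) simp
    then show "snd (\<Psi> (fst p, f p)) = snd p" by (simp add: \<Phi>_def)
    fix t c assume "\<bar>t - fst p\<bar> < min d e" "\<bar>c - f p\<bar> < min d e"
    then have "t \<in> ball (fst p) d" "c \<in> ball (f p) e"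
      by (simp_all add: dist_real_def abs_minus_commute)
    then have tc: "(t, c) \<in> W" using d e AB by blast
    have \<Psi>_tc: "\<Psi> (t, c) = (t, snd (\<Psi> (t, c)))" using pair[OF tc] by simp
    show "b (t, snd (\<Psi> (t, c))) \<noteq> 0"
      using \<Psi>(1)[OF tc] r \<Psi>_tc by (metis (mono_tags) mem_Collect_eq subsetD)
    show "((\<lambda>w. snd (\<Psi> w)) has_derivative
        (\<lambda>h. slope (t, snd (\<Psi> (t, c))) * fst h + snd h / b (t, snd (\<Psi> (t, c))))) (at (t, c))"
      using der[OF tc] unfolding \<Psi>_tc[symmetric] .
  qed
qed

text \<open>Level curves of \<open>f\<close> are straight, and \<open>1 / b\<close> is affine along them. In the coordinates \<open>(t, c)\<close>
  of the chart above, the identity \<open>dg = slope * df\<close> says that \<open>g\<close> depends on \<open>c\<close> alone and that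
  \<open>slope\<close> is its derivative in \<open>c\<close>; hence \<open>slope\<close> depends on \<open>c\<close> alone too. As \<open>slope\<close> is also the
  derivative of \<open>Y\<close> in \<open>t\<close>, this gives \<open>Y (t, c) = Y (t\<^sub>0, c) + (t - t\<^sub>0) * m c\<close>. Only first
  derivatives of \<open>f\<close> and \<open>g\<close> occur, yet this formula makes \<open>m\<close> differentiable, being a difference
  quotient of two differentiable functions of \<open>c\<close>. Taking the derivative of the formula in \<open>c\<close>
  turns it into the claim about \<open>1 / b\<close>, the derivative of \<open>Y\<close> in \<open>c\<close>.

  The claim about \<open>1 / b\<close> is stated as a product equal to \<open>1\<close>: this is a closed condition that
  forces \<open>b \<noteq> 0\<close>.\<close>

lemma kernel_line_local:
  assumes p: "b p \<noteq> 0"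
  obtains \<delta> \<mu> where "\<delta> > 0"
    "\<And>t. \<bar>t\<bar> < \<delta> \<Longrightarrow> b (p + t *\<^sub>R (1, slope p)) * (1 / b p + t * \<mu>) = 1"
    "\<And>t. \<bar>t\<bar> < \<delta> \<Longrightarrow> a (p + t *\<^sub>R (1, slope p)) = - slope p * b (p + t *\<^sub>R (1, slope p))"
proof -
  obtain Y \<delta> where \<delta>: "\<delta> > 0" and Yp: "Y (fst p, f p) = snd p"
    and nz: "\<And>t c. \<bar>t - fst p\<bar> < \<delta> \<Longrightarrow> \<bar>c - f p\<bar> < \<delta> \<Longrightarrow> b (t, Y (t, c)) \<noteq> 0"
    and dY: "\<And>t c. \<bar>t - fst p\<bar> < \<delta> \<Longrightarrow> \<bar>c - f p\<bar> < \<delta> \<Longrightarrow>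
       (Y has_derivative (\<lambda>h. slope (t, Y (t, c)) * fst h + snd h / b (t, Y (t, c)))) (at (t, c))"
    by (rule level_chart[OF p]) blast
  let ?I = "{t. \<bar>t - fst p\<bar> < \<delta>}" and ?J = "{c. \<bar>c - f p\<bar> < \<delta>}"
  have I: "?I = ball (fst p) \<delta>" and J: "?J = ball (f p) \<delta>"
    by (auto simp: dist_real_def abs_minus_commute)
  have openJ: "open ?J" unfolding J by simp
  define m where "m t c = slope (t, Y (t, c))" for t c
  have Y_t: "((\<lambda>t. Y (t, c)) has_real_derivative m t c) (at t)" if "t \<in> ?I" "c \<in> ?J" for t c
  proof -
    have "((\<lambda>t. Y (t, c)) has_derivative (\<lambda>h. slope (t, Y (t, c)) * fst (h, 0::real) + snd (h, 0::real) / b (t, Y (t, c)))) (at t)"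
      using that by (intro has_derivative_compose[of "\<lambda>t. (t, c)" _ _ _ Y] dY) (auto intro!: derivative_eq_intros)
    then show ?thesis by (simp add: has_field_derivative_def m_def)
  qed
  have Y_c: "((\<lambda>c. Y (t, c)) has_real_derivative 1 / b (t, Y (t, c))) (at c)" if "t \<in> ?I" "c \<in> ?J" for t c
  proof -
    have "((\<lambda>c. Y (t, c)) has_derivative (\<lambda>h. slope (t, Y (t, c)) * fst (0::real, h) + snd (0::real, h) / b (t, Y (t, c)))) (at c)"
      using that by (intro has_derivative_compose[of "\<lambda>c. (t, c)" _ _ _ Y] dY) (auto intro!: derivative_eq_intros)
    moreover have "(\<lambda>h. h / x) = (*) (1 / x)" for x :: real by auto
    ultimately show ?thesis by (simp add: has_field_derivative_def)
  qed
  define K where "K t c = g (t, Y (t, c))" for t c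
  have dg: "((\<lambda>s. g (u s)) has_derivative (\<lambda>h. k (u s) * fst (u' h) - a (u s) * snd (u' h))) (at s)"
    if "(u has_derivative u') (at s)" for u u' and s :: real
    by (rule has_derivative_compose[OF that deriv_g])
  have K_t: "((\<lambda>t. K t c) has_real_derivative 0) (at t)" if "t \<in> ?I" "c \<in> ?J" for t c
  proof -
    let ?z = "(t, Y (t, c))"
    have "((\<lambda>t. K t c) has_derivative (\<lambda>h. k ?z * fst (h, m t c * h) - a ?z * snd (h, m t c * h))) (at t)"
      unfolding K_def
      by (rule dg) (intro has_derivative_Pair has_derivative_ident Y_t[OF that, unfolded has_field_derivative_def])
    moreover have "b ?z \<noteq> 0" using nz that by simp
    then have "k ?z - a ?z * m t c = 0"
      unfolding m_def using k_eq a_eq by (simp add: power2_eq_square)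
    then have "(\<lambda>h. k ?z * fst (h, m t c * h) - a ?z * snd (h, m t c * h)) = (*) 0"
      by (auto simp: fun_eq_iff algebra_simps)
    ultimately show ?thesis by (simp add: has_field_derivative_def)
  qed
  have K_c: "((\<lambda>c. K t c) has_real_derivative m t c) (at c)" if "t \<in> ?I" "c \<in> ?J" for t c
  proof -
    let ?z = "(t, Y (t, c))"
    have "((\<lambda>c. K t c) has_derivative (\<lambda>h. k ?z * fst (0::real, 1 / b ?z * h) - a ?z * snd (0::real, 1 / b ?z * h))) (at c)"
      unfolding K_def
      by (rule dg) (intro has_derivative_Pair has_derivative_const Y_c[OF that, unfolded has_field_derivative_def])
    moreover have "b ?z \<noteq> 0" using nz that by simp
    then have "(\<lambda>h. k ?z * fst (0::real, 1 / b ?z * h) - a ?z * snd (0::real, 1 / b ?z * h)) = (*) (m t c)"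
      unfolding m_def using a_eq by (auto simp: fun_eq_iff)
    ultimately show ?thesis by (simp add: has_field_derivative_def)
  qed
  have K_const: "K t c = K (fst p) c" if "t \<in> ?I" "c \<in> ?J" for t c
  proof -
    have "\<exists>C. \<forall>t\<in>?I. K t c = C"
      unfolding I using K_t[OF _ that(2)] unfolding I
      by (intro has_field_derivative_zero_constant convex_ball) (blast intro: has_field_derivative_at_within)
    then show ?thesis using that(1) \<delta> by auto
  qed
  have m_const: "m t c = m (fst p) c" if t: "t \<in> ?I" and c: "c \<in> ?J" for t c
  proof -
    have "((\<lambda>c. K (fst p) c) has_real_derivative m t c) (at c)"
      by (rule has_field_derivative_transform_within_open[OF K_c[OF t c] openJ c])
         (use K_const[OF t] in simp)
    moreover have "((\<lambda>c. K (fst p) c) has_real_derivative m (fst p) c) (at c)"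
      by (rule K_c) (use \<delta> c in auto)
    ultimately show ?thesis by (rule DERIV_unique)
  qed
  have Y_eq: "Y (t, c) = Y (fst p, c) + (t - fst p) * m (fst p) c" if t: "t \<in> ?I" and c: "c \<in> ?J" for t c
  proof -
    have "\<exists>C. \<forall>t\<in>?I. Y (t, c) - (t - fst p) * m (fst p) c = C"
      unfolding I
    proof (intro has_field_derivative_zero_constant convex_ball)
      fix t assume "t \<in> ball (fst p) \<delta>"
      then have t: "t \<in> ?I" using I by blast
      show "((\<lambda>t. Y (t, c) - (t - fst p) * m (fst p) c) has_real_derivative 0) (at t within ball (fst p) \<delta>)"
        by (rule has_field_derivative_at_within)
           (auto intro!: derivative_eq_intros Y_t[OF t c] simp: m_const[OF t c])
    qed
    then obtain C where "\<And>t. t \<in> ?I \<Longrightarrow> Y (t, c) - (t - fst p) * m (fst p) c = C" by blast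
    from this[OF t] this[of "fst p"] \<delta> show ?thesis by simp
  qed
  have c0: "f p \<in> ?J" using \<delta> by simp
  have p0: "fst p \<in> ?I" using \<delta> by simp
  have m0: "m (fst p) (f p) = slope p" by (simp add: m_def Yp)
  \<comment> \<open>The number \<open>\<mu>\<close> is the derivative of \<open>m\<close> at \<open>f p\<close>, read off from the formula for \<open>Y\<close> at one
    abscissa other than that of \<open>p\<close>.\<close>
  define \<mu> where "\<mu> = (1 / b (fst p + \<delta>/2, Y (fst p + \<delta>/2, f p)) - 1 / b p) / (\<delta>/2)"
  have dm: "(m (fst p) has_real_derivative \<mu>) (at (f p))"
  proof -
    have t1: "fst p + \<delta>/2 \<in> ?I" using \<delta> by simp
    have "((\<lambda>c. (Y (fst p + \<delta>/2, c) - Y (fst p, c)) / (\<delta>/2)) has_real_derivative \<mu>) (at (f p))"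
      unfolding \<mu>_def using Y_c[OF p0 c0] \<delta>
      by (auto intro!: derivative_eq_intros Y_c[OF t1 c0] simp: Yp)
    then show ?thesis
      by (rule has_field_derivative_transform_within_open[OF _ openJ c0])
         (use Y_eq[OF t1] \<delta> in simp)
  qed
  have point: "(fst p + t, Y (fst p + t, f p)) = p + t *\<^sub>R (1, slope p)" if "\<bar>t\<bar> < \<delta>" for t
    using Y_eq[of "fst p + t", OF _ c0] that Yp m0 by (auto simp: prod_eq_iff)
  show thesis
  proof (rule that[OF \<delta>])
    fix t assume t: "\<bar>t\<bar> < \<delta>"
    then have tI: "fst p + t \<in> ?I" by simp
    let ?z = "p + t *\<^sub>R (1, slope p)"
    have bz: "b ?z \<noteq> 0" using nz[OF _ , of "fst p + t" "f p"] t \<delta> point[OF t] by simp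
    have "((\<lambda>c. Y (fst p, c) + t * m (fst p) c) has_real_derivative 1 / b ?z) (at (f p))"
      by (rule has_field_derivative_transform_within_open[OF Y_c[OF tI c0, unfolded point[OF t]] openJ c0])
         (use Y_eq[OF tI] in simp)
    moreover have "((\<lambda>c. Y (fst p, c) + t * m (fst p) c) has_real_derivative 1 / b p + t * \<mu>) (at (f p))"
      using Y_c[OF p0 c0] dm by (auto intro!: derivative_eq_intros simp: Yp)
    ultimately have "1 / b ?z = 1 / b p + t * \<mu>" by (rule DERIV_unique)
    then show "b ?z * (1 / b p + t * \<mu>) = 1" using bz by (metis nonzero_divide_eq_eq mult.commute)
    have "slope ?z = slope p"
      using m_const[OF tI c0] m0 point[OF t] by (simp add: m_def)
    then show "a ?z = - slope p * b ?z" using a_eq[OF bz] by simp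
  qed
qed

text \<open>The local statement continues along the whole line. The set \<open>C\<close> of parameters at which \<open>1 / b\<close>
  is given by the affine formula found near \<open>p\<close>, and the kernel direction is still that of \<open>p\<close>, is
  closed, so \<open>b\<close> cannot tend to zero at a finite parameter. At a boundary point of the
  interior of \<open>C\<close> the local statement provides another affine formula. The two agree at that point
  and at a second one, hence everywhere, and so the boundary point is interior after all.\<close>

lemma kernel_line:
  assumes p: "b p \<noteq> 0"
  shows "b (p + t *\<^sub>R (1, slope p)) \<noteq> 0" (is ?nz)
    and "slope (p + t *\<^sub>R (1, slope p)) = slope p" (is ?slope)
proof -
  define L where "L t = p + t *\<^sub>R (1, slope p)" for t
  have L_add: "L (t + s) = L t + s *\<^sub>R (1, slope p)" for s t
    by (simp add: L_def algebra_simps)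
  obtain \<delta> \<mu> where "\<delta> > 0"
    and loc: "\<And>t. \<bar>t\<bar> < \<delta> \<Longrightarrow> b (L t) * (1 / b p + t * \<mu>) = 1"
      "\<And>t. \<bar>t\<bar> < \<delta> \<Longrightarrow> a (L t) = - slope p * b (L t)"
    unfolding L_def by (rule kernel_line_local[OF p]) blast
  define C where "C = {t. b (L t) * (1 / b p + t * \<mu>) = 1 \<and> a (L t) = - slope p * b (L t)}"
  have "continuous_on UNIV (\<lambda>t. b (L t))" "continuous_on UNIV (\<lambda>t. a (L t))"
    unfolding L_def
    by (intro continuous_on_compose2[OF cont_b] continuous_on_compose2[OF cont_a] continuous_intros subset_UNIV)+
  then have "closed C"
    unfolding C_def by (intro closed_Collect_conj closed_Collect_eq continuous_intros)
  have C: "b (L t) \<noteq> 0" "slope (L t) = slope p" "1 / b (L t) = 1 / b p + t * \<mu>" if "t \<in> C" for t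
  proof -
    show "b (L t) \<noteq> 0" using that by (auto simp: C_def)
    then show "slope (L t) = slope p" using that by (simp add: C_def slope_def)
    show "1 / b (L t) = 1 / b p + t * \<mu>"
      using that \<open>b (L t) \<noteq> 0\<close> unfolding C_def by (simp add: divide_eq_eq mult.commute)
  qed
  have "ball 0 \<delta> \<subseteq> C" using loc by (auto simp: C_def dist_real_def)
  then have "0 \<in> interior C" using \<open>\<delta> > 0\<close> by (auto simp: mem_interior)
  have "closure (interior C) \<subseteq> interior C"
  proof
    fix t assume t: "t \<in> closure (interior C)"
    have tC: "t \<in> C"
      using t \<open>closed C\<close> by (meson closure_minimal interior_subset subsetD)
    obtain \<epsilon> \<nu> where "\<epsilon> > 0"
      and loc': "\<And>s. \<bar>s\<bar> < \<epsilon> \<Longrightarrow> b (L (t + s)) * (1 / b (L t) + s * \<nu>) = 1"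
        "\<And>s. \<bar>s\<bar> < \<epsilon> \<Longrightarrow> a (L (t + s)) = - slope p * b (L (t + s))"
      unfolding L_add by (rule kernel_line_local[OF C(1)[OF tC], unfolded C(2)[OF tC]]) blast
    show "t \<in> interior C"
    proof (rule ccontr)
      assume n: "t \<notin> interior C"
      obtain u where u: "u \<in> interior C" "dist u t < \<epsilon>"
        using t \<open>\<epsilon> > 0\<close> unfolding closure_approachable by blast
      have uC: "u \<in> C" using u interior_subset by blast
      have "u \<noteq> t" using u n by blast
      have "b (L u) * (1 / b (L t) + (u - t) * \<nu>) = 1"
        using loc'(1)[of "u - t"] u by (simp add: dist_real_def)
      then have "1 / b (L t) + (u - t) * \<nu> = 1 / b (L u)"
        using C(1)[OF uC] by (simp add: field_simps)
      then have "(u - t) * \<nu> = (u - t) * \<mu>"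
        unfolding C(3)[OF uC] C(3)[OF tC] by (simp add: algebra_simps)
      then have "\<nu> = \<mu>" using \<open>u \<noteq> t\<close> by simp
      have "ball t \<epsilon> \<subseteq> C"
      proof
        fix s assume "s \<in> ball t \<epsilon>"
        then have s: "\<bar>s - t\<bar> < \<epsilon>" by (simp add: dist_real_def abs_minus_commute)
        show "s \<in> C"
          using loc'[OF s] unfolding C_def \<open>\<nu> = \<mu>\<close> C(3)[OF tC] by (simp add: algebra_simps)
      qed
      then show False using n \<open>\<epsilon> > 0\<close> by (auto simp: mem_interior)
    qed
  qed
  then have "closed (interior C)" by (simp add: closure_subset_eq)
  then have "interior C = UNIV"
    using \<open>0 \<in> interior C\<close> clopen[of "interior C"] by auto
  then have "t \<in> C" using interior_subset by blast
  then show ?nz ?slope using C(1,2)[of t] by (simp_all add: L_def)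
qed

text \<open>Kernel lines of different slopes would meet, and at the common point the kernel would contain
  two directions although \<open>b\<close> does not vanish there.\<close>

lemma slope_unique:
  assumes p: "b p \<noteq> 0" and q: "b q \<noteq> 0"
  shows "slope p = slope q"
proof (rule ccontr)
  assume ne: "slope p \<noteq> slope q"
  define s where "s = (snd q - snd p - (fst q - fst p) * slope p) / (slope p - slope q)"
  have "p + (s + fst q - fst p) *\<^sub>R (1, slope p) = q + s *\<^sub>R (1, slope q)"
    using ne by (auto simp: prod_eq_iff s_def field_simps)
  then show False
    using kernel_line(2)[OF p] kernel_line(2)[OF q] ne by metis
qed

text \<open>The vector \<open>v = (cos \<alpha>, sin \<alpha>)\<close> lies in the kernel of \<open>DF\<close> at every point, and the image of \<open>DF\<close>
  lies in the span of \<open>v\<close> at every point; because of the trace, the two equations express either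
  fact. If \<open>b\<close> vanishes identically, \<open>v\<close> is vertical. Otherwise the slope \<open>m\<close> is the same wherever
  \<open>b \<noteq> 0\<close>, and what remains is to show \<open>k = - m\<^sup>2 * b\<close> also at the zeros of \<open>b\<close>. The function
  \<open>g - m * f\<close> depends on the first coordinate alone, and so does its derivative \<open>k + m\<^sup>2 * b\<close>. Each
  vertical line meets the kernel line of a point with \<open>b \<noteq> 0\<close>, and there \<open>k + m\<^sup>2 * b\<close> is zero.\<close>

lemma common_kernel:
  obtains \<alpha> where "\<And>z. a z * cos \<alpha> + b z * sin \<alpha> = 0" "\<And>z. k z * cos \<alpha> = a z * sin \<alpha>"
proof (cases "\<forall>z. b z = 0")
  case True
  then have "a z = 0" for z using det_zero[of z] by (simp del: split_paired_All)
  with True show thesis by (intro that[of "pi/2"]) auto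
next
  case False
  then obtain p where p: "b p \<noteq> 0" by blast
  define m where "m = slope p"
  have a: "a z = - m * b z" for z
  proof (cases "b z = 0")
    case True
    then show ?thesis using det_zero[of z] by simp
  next
    case False
    then show ?thesis using a_eq slope_unique[OF p False] by (simp add: m_def)
  qed
  define h where "h z = g z - m * f z" for z
  define d where "d z = k z + m\<^sup>2 * b z" for z
  have dh: "(h has_derivative (\<lambda>v. d z * fst v)) (at z)" for z
  proof -
    have "(h has_derivative (\<lambda>v. (k z * fst v - a z * snd v) - m * (a z * fst v + b z * snd v))) (at z)"
      unfolding h_def by (intro has_derivative_diff deriv_g has_derivative_mult_right deriv_f)
    then show ?thesis by (simp add: a d_def algebra_simps power2_eq_square)
  qed
  have h_y: "h (x, y) = h (x, y')" for x y y'
  proof (rule DERIV_isconst_all[of "\<lambda>y. h (x, y)"], rule allI)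
    fix y
    have "((\<lambda>y. h (x, y)) has_derivative (\<lambda>s. d (x, y) * fst (0::real, s))) (at y)"
      by (rule has_derivative_compose[OF _ dh]) (auto intro!: derivative_eq_intros)
    then show "((\<lambda>y. h (x, y)) has_real_derivative 0) (at y)"
      by (simp add: has_field_derivative_def lambda_zero)
  qed
  have h_x: "((\<lambda>x. h (x, y)) has_real_derivative d (x, y)) (at x)" for x y
  proof -
    have "((\<lambda>x. h (x, y)) has_derivative (\<lambda>s. d (x, y) * fst (s, 0::real))) (at x)"
      by (rule has_derivative_compose[OF _ dh]) (auto intro!: derivative_eq_intros)
    then show ?thesis by (simp add: has_field_derivative_def)
  qed
  have d_y: "d (x, y) = d (x, y')" for x y y'
    using h_x[of y x] h_x[of y' x] unfolding h_y[of _ y y'] by (rule DERIV_unique)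
  have d0: "d z = 0" for z
  proof -
    define q where "q = p + (fst z - fst p) *\<^sub>R (1, m)"
    have "b q \<noteq> 0" unfolding q_def m_def by (rule kernel_line(1)[OF p])
    then have "d q = 0"
      using k_eq slope_unique[OF p \<open>b q \<noteq> 0\<close>] by (simp add: d_def m_def)
    moreover have "fst q = fst z" by (simp add: q_def)
    then have "d z = d q" using d_y by (metis prod.collapse)
    ultimately show ?thesis by simp
  qed
  have sin_eq: "sin (arctan m) = m * cos (arctan m)"
    by (simp add: sin_arctan cos_arctan)
  show thesis
  proof (rule that[of "arctan m"])
    fix z
    show "a z * cos (arctan m) + b z * sin (arctan m) = 0"
      by (simp add: a sin_eq)
    have "k z = - m\<^sup>2 * b z" using d0[of z] by (simp add: d_def)
    then show "k z * cos (arctan m) = a z * sin (arctan m)"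
      by (simp add: a sin_eq power2_eq_square)
  qed
qed

text \<open>Integration of the previous lemma: \<open>F\<close> is constant in the direction \<open>v = (cos \<alpha>, sin \<alpha>)\<close>, and it
  takes its values in the span of \<open>v\<close> because it does so at the origin. Hence \<open>F\<close> is determined by its
  component along \<open>v\<close> on the line spanned by the orthogonal vector \<open>w\<close>.\<close>

lemma shear_form:
  assumes "f 0 = 0" "g 0 = 0"
  obtains \<alpha> \<psi> where "\<psi> C1_differentiable_on UNIV" "\<psi> 0 = 0"
    "\<And>z. f z = \<psi> (cos \<alpha> * snd z - sin \<alpha> * fst z) * cos \<alpha>"
    "\<And>z. g z = \<psi> (cos \<alpha> * snd z - sin \<alpha> * fst z) * sin \<alpha>"
proof -
  obtain \<alpha> where ker: "\<And>z. a z * cos \<alpha> + b z * sin \<alpha> = 0" "\<And>z. k z * cos \<alpha> = a z * sin \<alpha>"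
    by (rule common_kernel) blast
  define w where "w = (- sin \<alpha>, cos \<alpha>)"
  define \<psi> where "\<psi> y = cos \<alpha> * f (y *\<^sub>R w) + sin \<alpha> * g (y *\<^sub>R w)" for y
  define D where "D y = cos \<alpha> * (a (y *\<^sub>R w) * fst w + b (y *\<^sub>R w) * snd w)
      + sin \<alpha> * (k (y *\<^sub>R w) * fst w - a (y *\<^sub>R w) * snd w)" for y
  have along: "((\<lambda>t. f (z + t *\<^sub>R v)) has_real_derivative (a (z + t *\<^sub>R v) * fst v + b (z + t *\<^sub>R v) * snd v)) (at t)"
    "((\<lambda>t. g (z + t *\<^sub>R v)) has_real_derivative (k (z + t *\<^sub>R v) * fst v - a (z + t *\<^sub>R v) * snd v)) (at t)" for z v t
  proof -
    have v: "((\<lambda>t. z + t *\<^sub>R v) has_derivative (\<lambda>s. s *\<^sub>R v)) (at t)"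
      by (auto intro!: derivative_eq_intros)
    show "((\<lambda>t. f (z + t *\<^sub>R v)) has_real_derivative (a (z + t *\<^sub>R v) * fst v + b (z + t *\<^sub>R v) * snd v)) (at t)"
      unfolding has_field_derivative_def
      by (rule has_derivative_eq_rhs[OF has_derivative_compose[OF v deriv_f]]) (auto simp: algebra_simps)
    show "((\<lambda>t. g (z + t *\<^sub>R v)) has_real_derivative (k (z + t *\<^sub>R v) * fst v - a (z + t *\<^sub>R v) * snd v)) (at t)"
      unfolding has_field_derivative_def
      by (rule has_derivative_eq_rhs[OF has_derivative_compose[OF v deriv_g]]) (auto simp: algebra_simps)
  qed
  have C1: "\<psi> C1_differentiable_on UNIV"
    unfolding C1_differentiable_on_def
  proof (intro exI conjI ballI)
    fix y
    show "(\<psi> has_vector_derivative D y) (at y)"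
      unfolding \<psi>_def D_def has_real_derivative_iff_has_vector_derivative[symmetric]
      by (intro DERIV_add DERIV_cmult along[of 0, simplified])
    show "continuous_on UNIV D"
      unfolding D_def
      by (intro continuous_intros continuous_on_compose2[OF cont_a] continuous_on_compose2[OF cont_b]
          continuous_on_compose2[OF cont_k] subset_UNIV)
  qed
  have const_v: "f (z + t *\<^sub>R (cos \<alpha>, sin \<alpha>)) = f z" "g (z + t *\<^sub>R (cos \<alpha>, sin \<alpha>)) = g z" for z t
  proof -
    have "f (z + t *\<^sub>R (cos \<alpha>, sin \<alpha>)) = f (z + 0 *\<^sub>R (cos \<alpha>, sin \<alpha>))"
      using along(1)[of z "(cos \<alpha>, sin \<alpha>)"] by (intro DERIV_isconst_all allI) (simp add: ker(1))
    then show "f (z + t *\<^sub>R (cos \<alpha>, sin \<alpha>)) = f z" by (simp flip: zero_prod_def)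
    have "g (z + t *\<^sub>R (cos \<alpha>, sin \<alpha>)) = g (z + 0 *\<^sub>R (cos \<alpha>, sin \<alpha>))"
      using along(2)[of z "(cos \<alpha>, sin \<alpha>)"] by (intro DERIV_isconst_all allI) (simp add: ker(2))
    then show "g (z + t *\<^sub>R (cos \<alpha>, sin \<alpha>)) = g z" by (simp flip: zero_prod_def)
  qed
  \<comment> \<open>\<open>F\<close> is parallel to \<open>(cos \<alpha>, sin \<alpha>)\<close>: its orthogonal component has zero derivative on each ray
    from the origin.\<close>
  have normal: "cos \<alpha> * g z = sin \<alpha> * f z" for z
  proof -
    have "((\<lambda>t. cos \<alpha> * g (0 + t *\<^sub>R z) - sin \<alpha> * f (0 + t *\<^sub>R z)) has_real_derivative 0) (at t)" for t
    proof -
      let ?z = "0 + t *\<^sub>R z"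
      have "cos \<alpha> * (k ?z * fst z - a ?z * snd z) - sin \<alpha> * (a ?z * fst z + b ?z * snd z)
          = (k ?z * cos \<alpha> - a ?z * sin \<alpha>) * fst z - (a ?z * cos \<alpha> + b ?z * sin \<alpha>) * snd z"
        by (simp add: algebra_simps)
      also have "\<dots> = 0" by (simp only: ker) simp
      finally have zero: "cos \<alpha> * (k ?z * fst z - a ?z * snd z) - sin \<alpha> * (a ?z * fst z + b ?z * snd z) = 0" .
      from DERIV_diff[OF DERIV_cmult[where c = "cos \<alpha>", OF along(2)[of 0 z t]] DERIV_cmult[where c = "sin \<alpha>", OF along(1)[of 0 z t]]]
      show ?thesis unfolding zero .
    qed
    then have "cos \<alpha> * g (0 + 1 *\<^sub>R z) - sin \<alpha> * f (0 + 1 *\<^sub>R z) = cos \<alpha> * g (0 + 0 *\<^sub>R z) - sin \<alpha> * f (0 + 0 *\<^sub>R z)"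
      by (intro DERIV_isconst_all[of "\<lambda>t. cos \<alpha> * g (0 + t *\<^sub>R z) - sin \<alpha> * f (0 + t *\<^sub>R z)"] allI)
    then show ?thesis using assms by simp
  qed
  show thesis
  proof (rule that[OF C1])
    show "\<psi> 0 = 0" using assms by (simp add: \<psi>_def)
    fix z
    let ?s = "cos \<alpha> * snd z - sin \<alpha> * fst z"
    have "z = ?s *\<^sub>R w + (cos \<alpha> * fst z + sin \<alpha> * snd z) *\<^sub>R (cos \<alpha>, sin \<alpha>)"
    proof (rule prod_eqI)
      have "c * (cos \<alpha> * cos \<alpha>) + c * (sin \<alpha> * sin \<alpha>) = c" for c
        by (simp add: sin_cos_squared_add3 flip: distrib_left)
      then show "fst z = fst (?s *\<^sub>R w + (cos \<alpha> * fst z + sin \<alpha> * snd z) *\<^sub>R (cos \<alpha>, sin \<alpha>))"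
        "snd z = snd (?s *\<^sub>R w + (cos \<alpha> * fst z + sin \<alpha> * snd z) *\<^sub>R (cos \<alpha>, sin \<alpha>))"
        by (simp_all add: w_def algebra_simps)
    qed
    then have z: "f z = f (?s *\<^sub>R w)" "g z = g (?s *\<^sub>R w)"
      using const_v by metis+
    have \<psi>: "\<psi> ?s = cos \<alpha> * f z + sin \<alpha> * g z" unfolding \<psi>_def z(1)[symmetric] z(2)[symmetric] ..
    have "\<psi> ?s * cos \<alpha> = cos \<alpha> * (cos \<alpha> * f z) + sin \<alpha> * (cos \<alpha> * g z)"
      unfolding \<psi> by (simp add: algebra_simps)
    also have "\<dots> = f z" unfolding normal by (rule cos_sin_mult)
    finally show "f z = \<psi> ?s * cos \<alpha>" ..
    have "\<psi> ?s * sin \<alpha> = cos \<alpha> * (sin \<alpha> * f z) + sin \<alpha> * (sin \<alpha> * g z)"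
      unfolding \<psi> by (simp add: algebra_simps)
    also have "\<dots> = g z" unfolding normal[symmetric] by (rule cos_sin_mult)
    finally show "g z = \<psi> ?s * sin \<alpha>" ..
  qed
qed

end

section \<open>Shears and rotations\<close>

lemma rotation_nth:
  "rotation \<theta> z $ 1 = cos \<theta> * z$1 - sin \<theta> * z$2"
  "rotation \<theta> z $ 2 = sin \<theta> * z$1 + cos \<theta> * z$2"
  by (simp_all add: rotation_def matrix_vector_mult_def sum_2)

lemma rotation_cancel: "rotation (- \<theta>) (rotation \<theta> z) = z" "rotation \<theta> (rotation (- \<theta>) z) = z"
  by (simp_all add: vec_eq_iff forall_2 rotation_nth algebra_simps cos_sin_mult)

text \<open>This is \<open>rotation (- \<theta>) \<circ> S \<circ> rotation \<theta>\<close> for the standard shear \<open>S (x, y) = (x + \<psi> y, y)\<close>.\<close>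

definition shear :: "real \<Rightarrow> (real \<Rightarrow> real) \<Rightarrow> real^2 \<Rightarrow> real^2" where
  "shear \<theta> \<psi> z = z + \<psi> (sin \<theta> * z$1 + cos \<theta> * z$2) *\<^sub>R vector [cos \<theta>, - sin \<theta>]"

lemma shear_nth:
  "shear \<theta> \<psi> z $ 1 = z$1 + \<psi> (sin \<theta> * z$1 + cos \<theta> * z$2) * cos \<theta>"
  "shear \<theta> \<psi> z $ 2 = z$2 - \<psi> (sin \<theta> * z$1 + cos \<theta> * z$2) * sin \<theta>"
  by (simp_all add: shear_def)

lemma rotation_conj_iff:
  "(\<forall>x y. (rotation \<theta> \<circ> G \<circ> rotation (- \<theta>)) (vector [x, y]) = vector [x + \<psi> y, y]) \<longleftrightarrow> G = shear \<theta> \<psi>"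
proof -
  have shear: "shear \<theta> \<psi> z = rotation (- \<theta>) (vector [rotation \<theta> z $ 1 + \<psi> (rotation \<theta> z $ 2), rotation \<theta> z $ 2])" for z
    by (simp add: vec_eq_iff forall_2 rotation_nth shear_nth algebra_simps cos_sin_mult)
  show ?thesis
  proof
    assume L: "\<forall>x y. (rotation \<theta> \<circ> G \<circ> rotation (- \<theta>)) (vector [x, y]) = vector [x + \<psi> y, y]"
    show "G = shear \<theta> \<psi>"
    proof
      fix z
      have "vector [rotation \<theta> z $ 1, rotation \<theta> z $ 2] = rotation \<theta> z"
        by (simp add: vec_eq_iff forall_2)
      then have "rotation \<theta> (G z) = vector [rotation \<theta> z $ 1 + \<psi> (rotation \<theta> z $ 2), rotation \<theta> z $ 2]"
        using L[rule_format, of "rotation \<theta> z $ 1" "rotation \<theta> z $ 2"] by (simp add: rotation_cancel)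
      then show "G z = shear \<theta> \<psi> z"
        unfolding shear by (metis rotation_cancel(1))
    qed
  next
    assume "G = shear \<theta> \<psi>"
    then show "\<forall>x y. (rotation \<theta> \<circ> G \<circ> rotation (- \<theta>)) (vector [x, y]) = vector [x + \<psi> y, y]"
      by (simp add: shear rotation_cancel)
  qed
qed

lemma linear_shear_iff: "linear (shear \<theta> \<psi>) \<longleftrightarrow> linear \<psi>"
proof
  assume "linear \<psi>"
  then interpret linear \<psi> .
  show "linear (shear \<theta> \<psi>)"
  proof (rule linearI)
    fix x y :: "real^2" and c :: real
    have "\<psi> (sin \<theta> * (x + y)$1 + cos \<theta> * (x + y)$2)
        = \<psi> (sin \<theta> * x$1 + cos \<theta> * x$2) + \<psi> (sin \<theta> * y$1 + cos \<theta> * y$2)"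
      by (simp add: algebra_simps flip: add)
    then show "shear \<theta> \<psi> (x + y) = shear \<theta> \<psi> x + shear \<theta> \<psi> y"
      by (simp add: shear_def algebra_simps)
    have "\<psi> (sin \<theta> * (c *\<^sub>R x)$1 + cos \<theta> * (c *\<^sub>R x)$2) = c * \<psi> (sin \<theta> * x$1 + cos \<theta> * x$2)"
      using scale[of c "sin \<theta> * x$1 + cos \<theta> * x$2"] by (simp add: algebra_simps)
    then show "shear \<theta> \<psi> (c *\<^sub>R x) = c *\<^sub>R shear \<theta> \<psi> x"
      by (simp add: shear_def algebra_simps)
  qed
next
  assume "linear (shear \<theta> \<psi>)"
  then interpret linear "shear \<theta> \<psi>" .
  define w :: "real^2" where "w = vector [sin \<theta>, cos \<theta>]"
  define H where "H y = rotation \<theta> (shear \<theta> \<psi> (y *\<^sub>R w)) $ 1" for y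
  have H_eq: "H y = \<psi> y" for y
  proof -
    have "sin \<theta> * (y * sin \<theta>) + cos \<theta> * (y * cos \<theta>) = y"
      using cos_sin_mult[of \<theta> y] by (simp add: algebra_simps)
    then show ?thesis
      by (simp add: H_def rotation_nth shear_nth w_def algebra_simps cos_sin_mult)
  qed
  have "linear H"
    by (rule linearI) (simp_all add: H_def scaleR_left.add add rotation_nth scale algebra_simps flip: scaleR_scaleR)
  moreover have "H = \<psi>" by (rule ext) (rule H_eq)
  ultimately show "linear \<psi>" by simp
qed

text \<open>The derivative is the identity plus the rank-one map \<open>h \<mapsto> \<psi>' * (w \<bullet> h) * v\<close>, with
  \<open>v = (cos \<theta>, - sin \<theta>)\<close> orthogonal to \<open>w = (sin \<theta>, cos \<theta>)\<close>. Such a rank-one map is nilpotent.\<close>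

lemma unipotent_shear:
  assumes \<psi>: "\<psi> C1_differentiable_on UNIV"
  shows "unipotent (shear \<theta> \<psi>)"
proof -
  obtain D where D: "\<And>y. (\<psi> has_real_derivative D y) (at y)"
    using \<psi> by (auto simp: C1_differentiable_on_def has_real_derivative_iff_has_vector_derivative)
  define v :: "real^2" where "v = vector [cos \<theta>, - sin \<theta>]"
  define l where "l z = sin \<theta> * z$1 + cos \<theta> * z$2" for z :: "real^2"
  have der: "(shear \<theta> \<psi> has_derivative (\<lambda>h. h + (l h * D (l z)) *\<^sub>R v)) (at z)" for z
  proof -
    have "bounded_linear l"
      unfolding l_def by (intro bounded_linear_add bounded_linear_const_mult bounded_linear_vec_nth)
    then have "(l has_derivative l) (at z)" by (rule bounded_linear_imp_has_derivative)
    from has_derivative_compose[OF this D[of "l z", unfolded has_field_derivative_def]]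
    have "((\<lambda>z. \<psi> (l z)) has_derivative (\<lambda>h. l h * D (l z))) (at z)"
      by (simp add: mult.commute)
    then show ?thesis
      unfolding shear_def l_def[symmetric] v_def[symmetric]
      by (intro has_derivative_add has_derivative_ident has_derivative_scaleR_left)
  qed
  have diff: "shear \<theta> \<psi> differentiable (at z)" for z
    using der unfolding differentiable_def by blast
  have "eigenvalues (map_matrix complex_of_real (jacobian (shear \<theta> \<psi>) (at z))) = {1}" for z
  proof -
    define J where "J = jacobian (shear \<theta> \<psi>) (at z)"
    have "(\<lambda>h. J *v h) = (\<lambda>h. h + (l h * D (l z)) *\<^sub>R v)"
      using diff[of z] der[of z] unfolding J_def jacobian_works by (rule has_derivative_unique)
    then have "J *v axis j 1 = axis j 1 + (l (axis j 1) * D (l z)) *\<^sub>R v" for j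
      by (rule fun_cong)
    then have "(J *v axis j 1) $ i = (axis j 1 + (l (axis j 1) * D (l z)) *\<^sub>R v) $ i" for i j
      by simp
    then have "J $ i $ j = axis j 1 $ i + l (axis j 1) * D (l z) * v $ i" for i j
      unfolding matrix_vector_mult_basis column_def by simp
    then show ?thesis
      unfolding J_def[symmetric]
      by (intro eigenvalues_eq_1) (simp_all add: l_def v_def axis_def)
  qed
  then show ?thesis using diff by (simp add: unipotent_def Spc_def)
qed

section \<open>Unipotent maps of the plane\<close>

text \<open>The displacement of \<open>G\<close>, transported to \<open>real \<times> real\<close> by \<open>P\<close>, is an instance of the locale. The angle
  changes sign because \<open>rotation \<theta>\<close> has to turn the direction \<open>(cos \<alpha>, sin \<alpha>)\<close> into the first
  axis.\<close>

lemma unipotent_imp_shear: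
  assumes C1: "C1_map G" and uni: "unipotent G" and zero: "G 0 = 0"
  obtains \<theta> \<psi> where "\<psi> C1_differentiable_on UNIV" "\<psi> 0 = 0" "G = shear \<theta> \<psi>"
proof -
  define J where "J z = jacobian G (at z)" for z
  have dG: "(G has_derivative (\<lambda>h. J z *v h)) (at z)" for z
    using C1 unfolding C1_map_def J_def jacobian_works by blast
  have contJ: "continuous_on UNIV (\<lambda>z. J z $ i $ j)" for i j
    using C1 unfolding C1_map_def J_def by (intro continuous_on_component) blast
  have J: "J z $ 1 $ 1 + J z $ 2 $ 2 = 2" "(J z $ 1 $ 1 - 1) * (J z $ 2 $ 2 - 1) = J z $ 1 $ 2 * J z $ 2 $ 1" for z
  proof -
    have "eigenvalues (map_matrix complex_of_real (J z)) \<subseteq> {1}"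
      using uni by (auto simp: unipotent_def Spc_def J_def)
    then show "J z $ 1 $ 1 + J z $ 2 $ 2 = 2" "(J z $ 1 $ 1 - 1) * (J z $ 2 $ 2 - 1) = J z $ 1 $ 2 * J z $ 2 $ 1"
      by (rule eigenvalues_subset_1D)+
  qed
  define P :: "real \<times> real \<Rightarrow> real^2" where "P z = vector [fst z, snd z]" for z
  have P_nth: "P z $ 1 = fst z" "P z $ 2 = snd z" for z by (simp_all add: P_def)
  have "linear P" by (rule linearI) (simp_all add: vec_eq_iff forall_2 P_nth)
  then have dP: "(P has_derivative P) (at z)" for z
    by (simp add: linear_imp_has_derivative)
  then have contP: "continuous_on UNIV P"
    by (meson continuous_at_imp_continuous_on has_derivative_continuous)
  have dGP: "((\<lambda>z. G (P z) $ i) has_derivative (\<lambda>h. J (P z) $ i $ 1 * fst h + J (P z) $ i $ 2 * snd h)) (at z)" for z i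
  proof -
    have "((\<lambda>z. G (P z) $ i) has_derivative (\<lambda>h. (J (P z) *v P h) $ i)) (at z)"
      by (rule bounded_linear.has_derivative[OF bounded_linear_vec_nth has_derivative_compose[OF dP dG]])
    then show ?thesis by (simp add: matrix_vector_mult_def sum_2 P_nth)
  qed
  interpret nilpotent_plane_map "\<lambda>z. G (P z) $ 1 - fst z" "\<lambda>z. G (P z) $ 2 - snd z"
    "\<lambda>z. J (P z) $ 1 $ 1 - 1" "\<lambda>z. J (P z) $ 1 $ 2" "\<lambda>z. J (P z) $ 2 $ 1"
  proof
    fix z
    have tr: "J (P z) $ 2 $ 2 = 2 - J (P z) $ 1 $ 1" using J(1)[of "P z"] by simp
    show "((\<lambda>z. G (P z) $ 1 - fst z) has_derivative (\<lambda>h. (J (P z) $ 1 $ 1 - 1) * fst h + J (P z) $ 1 $ 2 * snd h)) (at z)"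
      by (rule has_derivative_eq_rhs[OF has_derivative_diff[OF dGP has_derivative_fst[OF has_derivative_ident]]])
         (simp add: algebra_simps)
    show "((\<lambda>z. G (P z) $ 2 - snd z) has_derivative (\<lambda>h. J (P z) $ 2 $ 1 * fst h - (J (P z) $ 1 $ 1 - 1) * snd h)) (at z)"
      by (rule has_derivative_eq_rhs[OF has_derivative_diff[OF dGP has_derivative_snd[OF has_derivative_ident]]])
         (simp add: tr algebra_simps)
    show "(J (P z) $ 1 $ 1 - 1) * (J (P z) $ 1 $ 1 - 1) + J (P z) $ 1 $ 2 * J (P z) $ 2 $ 1 = 0"
      using J(2)[of "P z"] unfolding tr by (simp add: algebra_simps)
  qed (intro continuous_intros continuous_on_compose2[OF contJ contP] subset_UNIV)+
  have "P 0 = 0" by (simp add: vec_eq_iff forall_2 P_nth)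
  then have F0: "G (P 0) $ 1 - fst 0 = 0" "G (P 0) $ 2 - snd 0 = 0" by (simp_all add: zero)
  obtain \<alpha> \<psi> where \<psi>: "\<psi> C1_differentiable_on UNIV" "\<psi> 0 = 0"
    and eq: "\<And>z. G (P z) $ 1 - fst z = \<psi> (cos \<alpha> * snd z - sin \<alpha> * fst z) * cos \<alpha>"
      "\<And>z. G (P z) $ 2 - snd z = \<psi> (cos \<alpha> * snd z - sin \<alpha> * fst z) * sin \<alpha>"
    by (rule shear_form[OF F0]) blast
  have "G = shear (- \<alpha>) \<psi>"
  proof
    fix z :: "real^2"
    have z: "P (z$1, z$2) = z" by (simp add: vec_eq_iff forall_2 P_nth)
    show "G z = shear (- \<alpha>) \<psi> z"
      using eq[of "(z$1, z$2)"] unfolding z by (simp add: vec_eq_iff forall_2 shear_nth algebra_simps)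
  qed
  with \<psi> show thesis by (rule that)
qed

theorem theorem3p2:
  fixes G :: "real^2 \<Rightarrow> real^2"
  assumes "C1_map G"
  shows "(\<not> linear G \<and> unipotent G \<and> G (vector [0, 0]) = vector [0, 0]) \<longleftrightarrow>
    (\<exists>(\<theta>::real) (\<psi>::real \<Rightarrow> real).
       \<not> linear \<psi> \<and> \<psi> C1_differentiable_on UNIV \<and> \<psi> 0 = 0 \<and>
       (\<forall>x y. (rotation \<theta> \<circ> G \<circ> rotation (- \<theta>)) (vector [x, y]) = vector [x + \<psi> y, y]))"
proof -
  have zero: "vector [0, 0] = (0 :: real^2)"
    by (simp add: vec_eq_iff forall_2)
  have "(\<not> linear G \<and> unipotent G \<and> G 0 = 0) \<longleftrightarrow>
    (\<exists>\<theta> \<psi>. \<not> linear \<psi> \<and> \<psi> C1_differentiable_on UNIV \<and> \<psi> 0 = 0 \<and> G = shear \<theta> \<psi>)"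
  proof
    assume "\<not> linear G \<and> unipotent G \<and> G 0 = 0"
    then show "\<exists>\<theta> \<psi>. \<not> linear \<psi> \<and> \<psi> C1_differentiable_on UNIV \<and> \<psi> 0 = 0 \<and> G = shear \<theta> \<psi>"
      by (metis unipotent_imp_shear[OF assms] linear_shear_iff)
  next
    assume "\<exists>\<theta> \<psi>. \<not> linear \<psi> \<and> \<psi> C1_differentiable_on UNIV \<and> \<psi> 0 = 0 \<and> G = shear \<theta> \<psi>"
    then show "\<not> linear G \<and> unipotent G \<and> G 0 = 0"
      by (auto simp: linear_shear_iff unipotent_shear shear_def)
  qed
  then show ?thesis unfolding rotation_conj_iff zero .
qed

end
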